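(* Let $\mathcal X\subseteq\mathbb R^N$, $\ell\in\{1,\dots,N\}$, $\epsilon\ge0$, and let $\mathbf x_i,\mathbf x_{i'},\mathbf x_j,\mathbf x_{j'}\in\mathcal X$ be four records that differ only in their $\ell$th coordinate, with $x_{i,\ell}<x_{i',\ell}\le x_{j,\ell}<x_{j',\ell}$. Let $\mathbf y_k$ be an output and let $z(\mathbf y_k\mid\mathbf x)>0$ be given for $\mathbf x\in\{\mathbf x_i,\mathbf x_{i'},\mathbf x_j,\mathbf x_{j'}\}$, such that each pair among these satisfies the $(\epsilon,d_1)$-Lipschitz bound: $|\ln z(\mathbf y_k\mid\mathbf x)-\ln z(\mathbf y_k\mid\mathbf x')|\le\epsilon\,d_1(\mathbf x,\mathbf x')$ for all $\mathbf x,\mathbf x'\in\{\mathbf x_i,\mathbf x_{i'},\mathbf x_j,\mathbf x_{j'}\}$. Let $\mathbf x_a,\mathbf x_b\in\mathcal X$ be two records that differ from these four points only in the $\ell$th coordinate, with $x_{a,\ell}\in[x_{i,\ell},x_{i',\ell}]$ and $x_{b,\ell}\in[x_{j,\ell},x_{j',\ell}]$. Let $\hat z(\mathbf y_k\mid\mathbf x_a)$ be the one-dimensional log-convex interpolation at $\mathbf x_a$ from $\big(z(\mathbf y_k\mid\mathbf x_i),z(\mathbf y_k\mid\mathbf x_{i'})\big)$ and $\hat z(\mathbf y_k\mid\mathbf x_b)$ the one-dimensional log-convex interpolation at $\mathbf x_b$ from $\big(z(\mathbf y_k\mid\mathbf x_j),z(\mathbf y_k\mid\mathbf x_{j'})\big)$.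 Then $$|\ln\hat z(\mathbf y_k\mid\mathbf x_a)-\ln\hat z(\mathbf y_k\mid\mathbf x_b)|\le\epsilon\,d_1(\mathbf x_a,\mathbf x_b).$$
   Context: $d_1(\mathbf x_a,\mathbf x_b)=\sum_{\ell=1}^N|x_{a,\ell}-x_{b,\ell}|$. One-dimensional log-convex interpolation: if $\mathbf x_i,\mathbf x_{i'}$ differ only in the $\ell$th coordinate with $x_{i,\ell}<x_{i',\ell}$, and $\mathbf x_a$ agrees with them in all coordinates except possibly the $\ell$th, with $x_{a,\ell}\in[x_{i,\ell},x_{i',\ell}]$, then the interpolated value at $\mathbf x_a$ from $\big(z(\mathbf y_k\mid\mathbf x_i),z(\mathbf y_k\mid\mathbf x_{i'})\big)$ is defined by $\ln\hat z(\mathbf y_k\mid\mathbf x_a)=\lambda\ln z(\mathbf y_k\mid\mathbf x_i)+(1-\lambda)\ln z(\mathbf y_k\mid\mathbf x_{i'})$ with $\lambda=\dfrac{x_{i',\ell}-x_{a,\ell}}{x_{i',\ell}-x_{i,\ell}}$. *)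

theory Defs
  imports "HOL-Analysis.Analysis"
begin

definition d1 :: "real ^ 'n \<Rightarrow> real ^ 'n \<Rightarrow> real" where
  "d1 x x' = (\<Sum>m\<in>UNIV. \<bar>x $ m - x' $ m\<bar>)"

(* "Differ only in the l-th coordinate": equality in that coordinate is allowed too. *)
definition differ_only_in :: "'n \<Rightarrow> real ^ 'n \<Rightarrow> real ^ 'n \<Rightarrow> bool" where
  "differ_only_in l x x' \<longleftrightarrow> (\<forall>m. m \<noteq> l \<longrightarrow> x $ m = x' $ m)"

definition interp_weight :: "'n \<Rightarrow> real ^ 'n \<Rightarrow> real ^ 'n \<Rightarrow> real ^ 'n \<Rightarrow> real" where
  "interp_weight l x x' xa = (x' $ l - xa $ l) / (x' $ l - x $ l)"

(* The value at xa interpolated from the values u at x and v at x'; meaningful when x, x', xa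
   differ only in coordinate l, x $ l < x' $ l, xa $ l lies in between, and u, v > 0.
   The defining equation prescribes the logarithm; the lemma below shows that this
   is the only positive real satisfying it. *)
definition log_convex_interp ::
  "'n \<Rightarrow> real ^ 'n \<Rightarrow> real ^ 'n \<Rightarrow> real \<Rightarrow> real \<Rightarrow> real ^ 'n \<Rightarrow> real" where
  "log_convex_interp l x x' u v xa =
     exp (interp_weight l x x' xa * ln u + (1 - interp_weight l x x' xa) * ln v)"

lemma log_convex_interp_iff:
  "w = log_convex_interp l x x' u v xa \<longleftrightarrow>
     w > 0 \<and>
     ln w = interp_weight l x x' xa * ln u + (1 - interp_weight l x x' xa) * ln v"
  by (metis exp_gt_zero exp_ln ln_exp log_convex_interp_def)

end

theory Submission
  imports Defs
begin

(* Writing each interpolated logarithm as a convex combination of the values at its end points,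
   the difference of the two is a doubly convex combination of the four cross differences. Since
   the two intervals do not overlap, distances along the line are signed differences of
   coordinates, hence affine, so the same combination of the four bounds is the required one. *)

lemma d1_differ_only_in:
  assumes "differ_only_in l x y"
  shows "d1 x y = \<bar>x $ l - y $ l\<bar>"
proof -
  have "d1 x y = (\<Sum>m\<in>{l}. \<bar>x $ m - y $ m\<bar>)"
    unfolding d1_def
    by (rule sum.mono_neutral_right) (use assms in \<open>auto simp: differ_only_in_def\<close>)
  then show ?thesis by simp
qed

lemma interp_weight_bounds:
  assumes "x $ l < x' $ l" "xa $ l \<in> {x $ l..x' $ l}"
  shows "0 \<le> interp_weight l x x' xa" "interp_weight l x x' xa \<le> 1"
  using assms by (auto simp: interp_weight_def)

text \<open>The weight that mixes the logarithms also expresses \<open>xa $ l\<close> through the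
  end points, so averaging a bound that is affine in the coordinate gives exactly its value at
  \<open>xa $ l\<close>.\<close>

lemma interp_weight_combination:
  assumes "x $ l < x' $ l"
  shows "interp_weight l x x' xa * x $ l + (1 - interp_weight l x x' xa) * x' $ l = xa $ l"
proof -
  have "interp_weight l x x' xa * (x' $ l - x $ l) = x' $ l - xa $ l"
    using assms by (simp add: interp_weight_def)
  then show ?thesis by (simp add: algebra_simps)
qed

text \<open>The weights sum to 1, so \<open>c\<close> can be split as
  \<open>t * c + (1 - t) * c\<close>, and the triangle inequality applies to the two weighted
  differences.\<close>

lemma abs_convex_combination_diff_le:
  fixes c p q t u v :: real
  assumes "0 \<le> t" "t \<le> 1" "\<bar>u - c\<bar> \<le> p" "\<bar>v - c\<bar> \<le> q"
  shows "\<bar>(t * u + (1 - t) * v) - c\<bar> \<le> t * p + (1 - t) * q"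
proof -
  have "(t * u + (1 - t) * v) - c = t * (u - c) + (1 - t) * (v - c)"
    by (simp add: algebra_simps)
  also have "\<bar>\<dots>\<bar> \<le> t * \<bar>u - c\<bar> + (1 - t) * \<bar>v - c\<bar>"
    using assms(1,2) abs_triangle_ineq[of "t * (u - c)" "(1 - t) * (v - c)"]
    by (simp add: abs_mult)
  also have "\<dots> \<le> t * p + (1 - t) * q"
    using assms by (intro add_mono mult_left_mono) auto
  finally show ?thesis .
qed

theorem proposition2:
  fixes X :: "(real ^ 'n) set"
    and l :: 'n
    and \<epsilon> :: real
    and xi xi' xj xj' xa xb :: "real ^ 'n"
    and yk :: 'y
    and z :: "'y \<Rightarrow> real ^ 'n \<Rightarrow> real"
  assumes "\<epsilon> \<ge> 0"
    and "{xi, xi', xj, xj'} \<subseteq> X"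
    and "\<forall>x\<in>{xi, xi', xj, xj'}. \<forall>x'\<in>{xi, xi', xj, xj'}. differ_only_in l x x'"
    and "xi $ l < xi' $ l" and "xi' $ l \<le> xj $ l" and "xj $ l < xj' $ l"
    and "\<forall>x\<in>{xi, xi', xj, xj'}. z yk x > 0"
    and "\<forall>x\<in>{xi, xi', xj, xj'}. \<forall>x'\<in>{xi, xi', xj, xj'}.
           \<bar>ln (z yk x) - ln (z yk x')\<bar> \<le> \<epsilon> * d1 x x'"
    and "xa \<in> X" and "xb \<in> X"
    and "\<forall>x\<in>{xi, xi', xj, xj'}. differ_only_in l xa x \<and> differ_only_in l xb x"
    and "xa $ l \<in> {xi $ l..xi' $ l}"
    and "xb $ l \<in> {xj $ l..xj' $ l}"
  shows "\<bar>ln (log_convex_interp l xi xi' (z yk xi) (z yk xi') xa)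
          - ln (log_convex_interp l xj xj' (z yk xj) (z yk xj') xb)\<bar> \<le> \<epsilon> * d1 xa xb"
proof -
  define s where "s = interp_weight l xi xi' xa"
  define t where "t = interp_weight l xj xj' xb"
  \<comment> \<open>\<open>A\<close> and \<open>B\<close> are the logarithms of the two interpolated
    values, as \<open>ln\<close> cancels the \<open>exp\<close> in
    \<open>log_convex_interp\<close>.\<close>
  define A where "A = s * ln (z yk xi) + (1 - s) * ln (z yk xi')"
  define B where "B = t * ln (z yk xj) + (1 - t) * ln (z yk xj')"
  have s: "0 \<le> s" "s \<le> 1" "s * xi $ l + (1 - s) * xi' $ l = xa $ l"
    unfolding s_def
    using interp_weight_bounds interp_weight_combination assms(4,12) by blast+
  have t: "0 \<le> t" "t \<le> 1" "t * xj $ l + (1 - t) * xj' $ l = xb $ l"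
    unfolding t_def
    using interp_weight_bounds interp_weight_combination assms(6,13) by blast+
  \<comment> \<open>Every point of the left pair lies weakly left of every point of the right pair,
    so \<open>d1\<close> loses its absolute value and the bound becomes affine in both
    coordinates.\<close>
  have cross: "\<bar>ln (z yk x) - ln (z yk y)\<bar> \<le> \<epsilon> * (y $ l - x $ l)"
    if "x \<in> {xi, xi'}" "y \<in> {xj, xj'}" for x y
  proof -
    have "differ_only_in l x y" and "\<bar>ln (z yk x) - ln (z yk y)\<bar> \<le> \<epsilon> * d1 x y"
      using that assms(3,8) by blast+
    moreover have "x $ l \<le> y $ l"
      using that assms(4-6) by auto
    ultimately show ?thesis by (simp add: d1_differ_only_in)
  qed
  have "\<bar>B - A\<bar> \<le> t * (\<epsilon> * (xj $ l - xa $ l)) + (1 - t) * (\<epsilon> * (xj' $ l - xa $ l))"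
  proof -
    \<comment> \<open>The averaging is done one side at a time: first over the left pair with
      \<open>y\<close> fixed, then over the right pair with \<open>A\<close> as the fixed value
      \<open>c\<close>.\<close>
    have "\<bar>ln (z yk y) - A\<bar> \<le> \<epsilon> * (y $ l - xa $ l)" if "y \<in> {xj, xj'}" for y
    proof -
      have "\<bar>A - ln (z yk y)\<bar> \<le> s * (\<epsilon> * (y $ l - xi $ l)) + (1 - s) * (\<epsilon> * (y $ l - xi' $ l))"
        unfolding A_def
        by (rule abs_convex_combination_diff_le) (use s that cross in auto)
      also have "\<dots> = \<epsilon> * (y $ l - xa $ l)"
        unfolding s(3)[symmetric] by (simp add: algebra_simps)
      finally show ?thesis by (simp add: abs_minus_commute)
    qed
    then show ?thesis
      unfolding B_def by (intro abs_convex_combination_diff_le t) auto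
  qed
  also have "\<dots> = \<epsilon> * (xb $ l - xa $ l)"
    unfolding t(3)[symmetric] by (simp add: algebra_simps)
  \<comment> \<open>The chain \<open>xa $ l \<le> xi' $ l \<le> xj $ l \<le> xb $ l\<close> fixes
    the sign of the difference.\<close>
  also have "\<dots> = \<epsilon> * d1 xa xb"
  proof -
    have "differ_only_in l xa xb"
      using assms(11) by (simp add: differ_only_in_def)
    then show ?thesis
      using assms(5,12,13) by (simp add: d1_differ_only_in)
  qed
  finally show ?thesis
    by (simp add: log_convex_interp_def A_def B_def s_def t_def abs_minus_commute)
qed

end
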